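(* Let $\mathcal{T}$ be the wild-coloured simplicial tetrahedron with vertices $v_1,v_2,v_3,v_4$, whose edges $\{v_1,v_2\},\{v_3,v_4\}$ have colour $1$, edges $\{v_1,v_3\},\{v_2,v_4\}$ have colour $2$, and edges $\{v_1,v_4\},\{v_2,v_3\}$ have colour $3$. Let $(1,b,c)\in\Lambda$ be such that the triangle with these side lengths is acute- or right-angled, i.e. $$1+b^2\ge c^2,\quad b^2+c^2\ge 1,\quad 1+c^2\ge b^2.$$ Then there exist $x,h\in[0,\infty)$ with $(x,h)\neq(0,0)$ such that the map $\phi:\{v_1,v_2,v_3,v_4\}\to\mathbb{R}^3$ given by $$\phi(v_1)=\left(\tfrac12,0,0\right)^t,\ \phi(v_2)=\left(-\tfrac12,0,0\right)^t,\ \phi(v_3)=\left(\tfrac{x^2-1}{2(x^2+1)},\tfrac{x}{x^2+1},h\right)^t,\ \phi(v_4)=\left(\tfrac{-x^2+1}{2(x^2+1)},\tfrac{-x}{x^2+1},h\right)^t$$ is a strong $(1,b,c)$-embedding of $\mathcal{T}$.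
   Context: $\Lambda$ is the set of triples of positive reals satisfying the (non-strict) triangle inequalities. The simplicial tetrahedron is the simplicial surface with faces $\{v_1,v_2,v_3\},\{v_1,v_2,v_4\},\{v_1,v_3,v_4\},\{v_2,v_3,v_4\}$ (and all their nonempty subsets as edges and vertices). A wild-colouring of a simplicial surface is a map from its edges to $\{1,2,3\}$ that is bijective on the three edges of every face. For a wild-coloured simplicial surface $X$ and $(\ell_1,\ell_2,\ell_3)\in\Lambda$, a weak $(\ell_1,\ell_2,\ell_3)$-embedding is a map $\phi$ from the vertex set of $X$ to $\mathbb{R}^3$ such that for every edge $\{u,u'\}$ of colour $p$ we have $\|\phi(u)-\phi(u')\|=\ell_p$ (Euclidean norm); it is a strong embedding if $\phi$ is moreover injective.
   Formalization: If c² = 1 + b² (e.g. b = 1, c = √2) no finite x works, since c² − b² = (x²−1)/(x²+1) < 1; in that case it is proved instead that for some h ≥ 0 the limit of the maps φ as x → ∞ is a strong (1,b,c)-embedding. Otherwise the claim is as stated. *)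

theory Defs
  imports "HOL-Analysis.Analysis"
begin

definition Lambda_triples :: "(real \<times> real \<times> real) set" where
  "Lambda_triples =
     {(l1, l2, l3). 0 < l1 \<and> 0 < l2 \<and> 0 < l3 \<and> l1 \<le> l2 + l3 \<and> l2 \<le> l1 + l3 \<and> l3 \<le> l1 + l2}"

text \<open>
  A simplicial surface is represented by its set of faces (3-element vertex sets); its
  simplices are the nonempty subsets of the faces. The notions of colouring and embedding
  only use this incidence structure.
\<close>

definition surf_vertices :: "'v set set \<Rightarrow> 'v set" where
  "surf_vertices F = \<Union>F"

definition surf_edges :: "'v set set \<Rightarrow> 'v set set" where
  "surf_edges F = {e. card e = 2 \<and> (\<exists>f\<in>F. e \<subseteq> f)}"

definition wild_colouring :: "'v set set \<Rightarrow> ('v set \<Rightarrow> nat) \<Rightarrow> bool" where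
  "wild_colouring F w \<longleftrightarrow>
     w ` surf_edges F \<subseteq> {1, 2, 3} \<and>
     (\<forall>f\<in>F. bij_betw w {e \<in> surf_edges F. e \<subseteq> f} {1, 2, 3})"

fun colour_length :: "real \<times> real \<times> real \<Rightarrow> nat \<Rightarrow> real" where
  "colour_length (l1, l2, l3) p = (if p = 1 then l1 else if p = 2 then l2 else l3)"

definition weak_embedding ::
  "'v set set \<Rightarrow> ('v set \<Rightarrow> nat) \<Rightarrow> real \<times> real \<times> real \<Rightarrow> ('v \<Rightarrow> real ^ 3) \<Rightarrow> bool" where
  "weak_embedding F w l \<phi> \<longleftrightarrow>
     (\<forall>u u'. {u, u'} \<in> surf_edges F \<longrightarrow> norm (\<phi> u - \<phi> u') = colour_length l (w {u, u'}))"

definition strong_embedding ::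
  "'v set set \<Rightarrow> ('v set \<Rightarrow> nat) \<Rightarrow> real \<times> real \<times> real \<Rightarrow> ('v \<Rightarrow> real ^ 3) \<Rightarrow> bool" where
  "strong_embedding F w l \<phi> \<longleftrightarrow> weak_embedding F w l \<phi> \<and> inj_on \<phi> (surf_vertices F)"

datatype tetra_vertex = V1 | V2 | V3 | V4

definition tetra_faces :: "tetra_vertex set set" where
  "tetra_faces = {{V1, V2, V3}, {V1, V2, V4}, {V1, V3, V4}, {V2, V3, V4}}"

text \<open>The value 0 is only taken off the edges of the tetrahedron.\<close>

definition tetra_colour :: "tetra_vertex set \<Rightarrow> nat" where
  "tetra_colour e =
     (if e = {V1, V2} \<or> e = {V3, V4} then 1
      else if e = {V1, V3} \<or> e = {V2, V4} then 2
      else if e = {V1, V4} \<or> e = {V2, V3} then 3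
      else 0)"

fun tetra_map :: "real \<Rightarrow> real \<Rightarrow> tetra_vertex \<Rightarrow> real ^ 3" where
  "tetra_map x h V1 = vector [1 / 2, 0, 0]"
| "tetra_map x h V2 = vector [- 1 / 2, 0, 0]"
| "tetra_map x h V3 = vector [(x\<^sup>2 - 1) / (2 * (x\<^sup>2 + 1)), x / (x\<^sup>2 + 1), h]"
| "tetra_map x h V4 = vector [(- x\<^sup>2 + 1) / (2 * (x\<^sup>2 + 1)), - x / (x\<^sup>2 + 1), h]"

lemma surf_vertices_tetra: "surf_vertices tetra_faces = {V1, V2, V3, V4}"
  by (auto simp: surf_vertices_def tetra_faces_def)

lemma surf_edges_tetra:
  "surf_edges tetra_faces = {{V1, V2}, {V1, V3}, {V1, V4}, {V2, V3}, {V2, V4}, {V3, V4}}"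
  (is "_ = ?E")
proof
  show "surf_edges tetra_faces \<subseteq> ?E"
  proof
    fix e assume "e \<in> surf_edges tetra_faces"
    then obtain a b where "e = {a, b}" "a \<noteq> b"
      by (auto simp: surf_edges_def card_2_iff)
    then show "e \<in> ?E"
      by (cases a; cases b) (auto simp: insert_commute)
  qed
  show "?E \<subseteq> surf_edges tetra_faces"
    by (auto simp: surf_edges_def tetra_faces_def)
qed

lemma wild_colouring_tetra: "wild_colouring tetra_faces tetra_colour"
proof -
  have E: "{e \<in> surf_edges tetra_faces. e \<subseteq> {V1, V2, V3}} = {{V1, V2}, {V1, V3}, {V2, V3}}"
    "{e \<in> surf_edges tetra_faces. e \<subseteq> {V1, V2, V4}} = {{V1, V2}, {V2, V4}, {V1, V4}}"
    "{e \<in> surf_edges tetra_faces. e \<subseteq> {V1, V3, V4}} = {{V3, V4}, {V1, V3}, {V1, V4}}"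
    "{e \<in> surf_edges tetra_faces. e \<subseteq> {V2, V3, V4}} = {{V3, V4}, {V2, V4}, {V2, V3}}"
    unfolding surf_edges_tetra by auto
  have C: "tetra_colour {V1, V2} = 1" "tetra_colour {V3, V4} = 1"
    "tetra_colour {V1, V3} = 2" "tetra_colour {V2, V4} = 2"
    "tetra_colour {V1, V4} = 3" "tetra_colour {V2, V3} = 3"
    by (auto simp: tetra_colour_def doubleton_eq_iff)
  have "tetra_colour ` surf_edges tetra_faces \<subseteq> {1, 2, 3}"
    unfolding surf_edges_tetra by (auto simp: C)
  moreover have "bij_betw tetra_colour {e \<in> surf_edges tetra_faces. e \<subseteq> f} {1, 2, 3}"
    if f: "f \<in> tetra_faces" for f
  proof -
    consider "f = {V1, V2, V3}" | "f = {V1, V2, V4}" | "f = {V1, V3, V4}" | "f = {V2, V3, V4}"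
      using f by (auto simp: tetra_faces_def)
    then show ?thesis
      by cases (simp_all only: E, auto simp: bij_betw_def inj_on_def C)
  qed
  ultimately show ?thesis by (simp add: wild_colouring_def)
qed

text \<open>
  If the side \<open>c\<close> is the hypotenuse of a right-angled triangle, no finite parameter \<open>x\<close> is
  possible: the edge of colour 2 would require \<open>1 / (x\<^sup>2 + 1) = 0\<close>. The embedding then
  arises only as the limit of the family for \<open>x\<close> tending to infinity, so this case is
  treated separately in the theorem.
\<close>

lemma no_finite_parameter:
  assumes "c\<^sup>2 = 1 + b\<^sup>2"
  shows "\<not> strong_embedding tetra_faces tetra_colour (1, b, c) (tetra_map x h)"
proof
  assume "strong_embedding tetra_faces tetra_colour (1, b, c) (tetra_map x h)"
  then have W: "norm (tetra_map x h u - tetra_map x h u') = colour_length (1, b, c) (tetra_colour {u, u'})"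
    if "{u, u'} \<in> surf_edges tetra_faces" for u u'
    using that by (simp add: strong_embedding_def weak_embedding_def)
  have "norm (tetra_map x h V1 - tetra_map x h V3) = b"
    using W[of V1 V3] by (simp add: surf_edges_tetra tetra_colour_def doubleton_eq_iff)
  then have B: "(1/2 - (x\<^sup>2 - 1) / (2 * (x\<^sup>2 + 1)))\<^sup>2 + (x / (x\<^sup>2 + 1))\<^sup>2 + h\<^sup>2 = b\<^sup>2"
    by (auto simp: norm_vec_def L2_set_def sum_3 sum_nonneg)
  have "norm (tetra_map x h V1 - tetra_map x h V4) = c"
    using W[of V1 V4] by (simp add: surf_edges_tetra tetra_colour_def doubleton_eq_iff)
  then have C: "(1/2 - (- x\<^sup>2 + 1) / (2 * (x\<^sup>2 + 1)))\<^sup>2 + (x / (x\<^sup>2 + 1))\<^sup>2 + h\<^sup>2 = c\<^sup>2"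
    by (auto simp: norm_vec_def L2_set_def sum_3 sum_nonneg)
  have p: "x\<^sup>2 + 1 > 0" by (simp add: add_nonneg_pos)
  define q where "q = 1 / (x\<^sup>2 + 1)"
  have q: "q > 0" using p by (simp add: q_def)
  have e: "(x\<^sup>2 - 1) / (2 * (x\<^sup>2 + 1)) = 1/2 - q" "(- x\<^sup>2 + 1) / (2 * (x\<^sup>2 + 1)) = q - 1/2"
    using p by (simp_all add: q_def field_simps)
  have "(1 - q)\<^sup>2 - q\<^sup>2 = 1"
    using B C assms unfolding e by (simp add: algebra_simps)
  then show False using q by (simp add: power2_eq_square algebra_simps)
qed

end

(*
  With q = 1 / (x^2 + 1) the squared edge lengths of the family are 1, q + h^2 and 1 - q + h^2,
  so the required values are q = (1 + b^2 - c^2) / 2 and h^2 = (b^2 + c^2 - 1) / 2. The angle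
  conditions give 0 <= q <= 1 and h^2 >= 0, where q = 0 corresponds to x tending to infinity.
*)
theory Submission
  imports Defs "HOL-Real_Asymp.Real_Asymp"
begin

text \<open>Any two distinct vertices of the tetrahedron span an edge, so the six norms cover the
  whole weak embedding condition, and positive lengths keep all images apart.\<close>

lemma strong_embedding_tetraI:
  fixes \<phi> :: "tetra_vertex \<Rightarrow> real ^ 3"
  assumes pos: "l1 > 0" "l2 > 0" "l3 > 0"
    and n1: "norm (\<phi> V1 - \<phi> V2) = l1" "norm (\<phi> V3 - \<phi> V4) = l1"
    and n2: "norm (\<phi> V1 - \<phi> V3) = l2" "norm (\<phi> V2 - \<phi> V4) = l2"
    and n3: "norm (\<phi> V1 - \<phi> V4) = l3" "norm (\<phi> V2 - \<phi> V3) = l3"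
  shows "strong_embedding tetra_faces tetra_colour (l1, l2, l3) \<phi>"
proof -
  \<comment> \<open>The case \<open>u = v\<close> must be excluded: a singleton has the default
    colour 0, to which \<open>colour_length\<close> assigns \<open>l3\<close>.\<close>
  have "norm (\<phi> u - \<phi> v) = colour_length (l1, l2, l3) (tetra_colour {u, v})" if "u \<noteq> v" for u v
    using that n1 n2 n3
    by (cases u; cases v) (simp_all add: tetra_colour_def doubleton_eq_iff norm_minus_commute)
  moreover have "u \<noteq> v" if "{u, v} \<in> surf_edges tetra_faces" for u v
    using that by (auto simp: surf_edges_def)
  moreover have "inj \<phi>"
  proof (rule injI)
    fix u v assume "\<phi> u = \<phi> v"
    then show "u = v"
      using pos n1 n2 n3 by (cases u; cases v) auto
  qed
  ultimately show ?thesis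
    unfolding strong_embedding_def weak_embedding_def by (blast intro: inj_on_subset)
qed

lemma norm_vector_3:
  "norm (vector [a1, a2, a3] - vector [b1, b2, b3] :: real ^ 3)
    = sqrt ((a1 - b1)\<^sup>2 + (a2 - b2)\<^sup>2 + (a3 - b3)\<^sup>2)"
  by (simp add: norm_vec_def L2_set_def sum_3)

lemma strong_embedding_tetra_map:
  fixes b c x h :: real
  assumes "b > 0" "c > 0"
    and b: "b\<^sup>2 = 1 / (x\<^sup>2 + 1) + h\<^sup>2" and c: "c\<^sup>2 = 1 - 1 / (x\<^sup>2 + 1) + h\<^sup>2"
  shows "strong_embedding tetra_faces tetra_colour (1, b, c) (tetra_map x h)"
proof -
  define q where "q = 1 / (x\<^sup>2 + 1)"
  define s where "s = x / (x\<^sup>2 + 1)"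
  have p: "x\<^sup>2 + 1 > 0" by (simp add: add_nonneg_pos)
  have V: "(x\<^sup>2 - 1) / (2 * (x\<^sup>2 + 1)) = 1/2 - q" "(- x\<^sup>2 + 1) / (2 * (x\<^sup>2 + 1)) = q - 1/2"
    "x / (x\<^sup>2 + 1) = s" "- x / (x\<^sup>2 + 1) = - s"
    using p by (simp_all add: q_def s_def field_simps)
  \<comment> \<open>This says that the horizontal parts of the images of \<open>V3\<close> and
    \<open>V4\<close> lie on the circle of radius 1/2 about the axis. With it \<open>s\<close> can
    be eliminated from every squared distance below, leaving identities in \<open>q\<close> and
    \<open>h\<close>.\<close>
  have s: "s\<^sup>2 = q - q\<^sup>2"
    using p by (simp add: q_def s_def power_divide divide_simps) (simp add: algebra_simps power2_eq_square)
  have b': "b\<^sup>2 = q + h\<^sup>2" and c': "c\<^sup>2 = 1 - q + h\<^sup>2"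
    using b c by (simp_all add: q_def)
  show ?thesis
  proof (rule strong_embedding_tetraI)
    show "norm (tetra_map x h V1 - tetra_map x h V2) = 1"
      by (simp add: norm_vector_3)
    show "norm (tetra_map x h V3 - tetra_map x h V4) = 1"
      unfolding tetra_map.simps V norm_vector_3
      using s by (intro real_sqrt_unique) (simp_all add: power2_eq_square algebra_simps)
    show "norm (tetra_map x h V1 - tetra_map x h V3) = b"
      unfolding tetra_map.simps V norm_vector_3
      using s b' \<open>b > 0\<close> by (intro real_sqrt_unique) (simp_all add: power2_eq_square algebra_simps)
    show "norm (tetra_map x h V2 - tetra_map x h V4) = b"
      unfolding tetra_map.simps V norm_vector_3
      using s b' \<open>b > 0\<close> by (intro real_sqrt_unique) (simp_all add: power2_eq_square algebra_simps)
    show "norm (tetra_map x h V1 - tetra_map x h V4) = c"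
      unfolding tetra_map.simps V norm_vector_3
      using s c' \<open>c > 0\<close> by (intro real_sqrt_unique) (simp_all add: power2_eq_square algebra_simps)
    show "norm (tetra_map x h V2 - tetra_map x h V3) = c"
      unfolding tetra_map.simps V norm_vector_3
      using s c' \<open>c > 0\<close> by (intro real_sqrt_unique) (simp_all add: power2_eq_square algebra_simps)
  qed (use assms in auto)
qed

text \<open>The images form a flat rectangle with sides 1 and \<open>h\<close> (for
  \<open>h > 0\<close>) whose diagonals are the edges of colour 3.\<close>

fun tetra_limit :: "real \<Rightarrow> tetra_vertex \<Rightarrow> real ^ 3" where
  "tetra_limit h V1 = vector [1 / 2, 0, 0]"
| "tetra_limit h V2 = vector [- 1 / 2, 0, 0]"
| "tetra_limit h V3 = vector [1 / 2, 0, h]"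
| "tetra_limit h V4 = vector [- 1 / 2, 0, h]"

lemma tendsto_vector_3:
  fixes f g k :: "'a \<Rightarrow> real"
  assumes "(f \<longlongrightarrow> a) F" "(g \<longlongrightarrow> b) F" "(k \<longlongrightarrow> c) F"
  shows "((\<lambda>x. vector [f x, g x, k x] :: real ^ 3) \<longlongrightarrow> vector [a, b, c]) F"
proof (rule vec_tendstoI)
  fix i :: 3
  show "((\<lambda>x. (vector [f x, g x, k x] :: real ^ 3) $ i) \<longlongrightarrow> vector [a, b, c] $ i) F"
    using assms exhaust_3[of i] by auto
qed

lemma tendsto_tetra_map: "((\<lambda>x. tetra_map x h v) \<longlongrightarrow> tetra_limit h v) at_top"
proof (cases v)
  case V3
  have "((\<lambda>x::real. (x\<^sup>2 - 1) / (2 * (x\<^sup>2 + 1))) \<longlongrightarrow> 1 / 2) at_top"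
    "((\<lambda>x::real. x / (x\<^sup>2 + 1)) \<longlongrightarrow> 0) at_top"
    by real_asymp+
  then show ?thesis using V3 by (simp add: tendsto_vector_3)
next
  case V4
  have "((\<lambda>x::real. (- x\<^sup>2 + 1) / (2 * (x\<^sup>2 + 1))) \<longlongrightarrow> - 1 / 2) at_top"
    "((\<lambda>x::real. - x / (x\<^sup>2 + 1)) \<longlongrightarrow> 0) at_top"
    by real_asymp+
  then show ?thesis
    unfolding V4 tetra_map.simps tetra_limit.simps by (intro tendsto_vector_3 tendsto_const)
qed simp_all

text \<open>The height is \<open>b\<close> because the upright sides of the rectangle have colour 2;
  Pythagoras then gives its diagonals the length \<open>c\<close>.\<close>

lemma strong_embedding_tetra_limit:
  fixes b c :: real
  assumes "b > 0" "c > 0" "c\<^sup>2 = 1 + b\<^sup>2"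
  shows "strong_embedding tetra_faces tetra_colour (1, b, c) (tetra_limit b)"
proof -
  have "sqrt (1 + b\<^sup>2) = c"
    using assms by (metis less_imp_le real_sqrt_unique)
  then show ?thesis
    using assms by (intro strong_embedding_tetraI) (simp_all add: norm_vector_3)
qed

text \<open>By \<open>no_finite_parameter\<close> the original claim fails when \<open>c\<close> is
  the hypotenuse; in that case the conclusion asks instead for a strong embedding that is a
  pointwise limit of the family at fixed height.\<close>

theorem mainTheorem2:
  fixes b c :: real
  assumes "(1, b, c) \<in> Lambda_triples"
    and "1 + b\<^sup>2 \<ge> c\<^sup>2" and "b\<^sup>2 + c\<^sup>2 \<ge> 1" and "1 + c\<^sup>2 \<ge> b\<^sup>2"
  shows "(c\<^sup>2 \<noteq> 1 + b\<^sup>2 \<longrightarrow>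
           (\<exists>x h. x \<ge> 0 \<and> h \<ge> 0 \<and> (x, h) \<noteq> (0, 0) \<and>
              strong_embedding tetra_faces tetra_colour (1, b, c) (tetra_map x h))) \<and>
         (c\<^sup>2 = 1 + b\<^sup>2 \<longrightarrow>
           (\<exists>h \<phi>. h \<ge> 0 \<and> (\<forall>v. ((\<lambda>x. tetra_map x h v) \<longlongrightarrow> \<phi> v) at_top) \<and>
              strong_embedding tetra_faces tetra_colour (1, b, c) \<phi>))"
proof (intro conjI impI)
  have pos: "b > 0" "c > 0"
    using assms(1) by (auto simp: Lambda_triples_def)
  {
    assume "c\<^sup>2 \<noteq> 1 + b\<^sup>2"
    define q where "q = (1 + b\<^sup>2 - c\<^sup>2) / 2"
    \<comment> \<open>This inverts \<open>q = 1 / (x\<^sup>2 + 1)\<close>, which requires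
      \<open>0 < q\<close> and \<open>q \<le> 1\<close>. The first combines one angle condition with
      the exclusion of equality, the second is the condition
      \<open>1 + c\<^sup>2 \<ge> b\<^sup>2\<close>.\<close>
    define x where "x = sqrt (1 / q - 1)"
    define h where "h = sqrt ((b\<^sup>2 + c\<^sup>2 - 1) / 2)"
    have q: "0 < q" "q \<le> 1"
      using assms \<open>c\<^sup>2 \<noteq> 1 + b\<^sup>2\<close> by (auto simp: q_def)
    have x2: "1 / (x\<^sup>2 + 1) = q"
      using q by (simp add: x_def)
    have h2: "h\<^sup>2 = (b\<^sup>2 + c\<^sup>2 - 1) / 2"
      using assms by (simp add: h_def)
    have b: "b\<^sup>2 = 1 / (x\<^sup>2 + 1) + h\<^sup>2" and c: "c\<^sup>2 = 1 - 1 / (x\<^sup>2 + 1) + h\<^sup>2"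
      unfolding x2 h2 by (simp_all add: q_def field_simps)
    have "x \<ge> 0" "h \<ge> 0"
      using q assms by (simp_all add: x_def h_def)
    \<comment> \<open>If both vanished, the formula for \<open>c\<^sup>2\<close> would give
      \<open>c = 0\<close>: the images of \<open>V2\<close> and \<open>V3\<close> would
      coincide.\<close>
    moreover have "(x, h) \<noteq> (0, 0)"
      using c pos by auto
    ultimately show "\<exists>x h. x \<ge> 0 \<and> h \<ge> 0 \<and> (x, h) \<noteq> (0, 0) \<and>
        strong_embedding tetra_faces tetra_colour (1, b, c) (tetra_map x h)"
      using strong_embedding_tetra_map[OF pos b c] by blast
  }
  {
    assume "c\<^sup>2 = 1 + b\<^sup>2"
    then show "\<exists>h \<phi>. h \<ge> 0 \<and> (\<forall>v. ((\<lambda>x. tetra_map x h v) \<longlongrightarrow> \<phi> v) at_top) \<and>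
        strong_embedding tetra_faces tetra_colour (1, b, c) \<phi>"
      using pos tendsto_tetra_map[of b] strong_embedding_tetra_limit[of b c] less_imp_le by blast
  }
qed

end
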